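(* Let $\mathbb{V}$ be the Viro (triangle) hyperfield, let $f:\mathbb{C}\to\mathbb{V}$, $f(z)=|z|$, and let $\overline{p}(T)=T^3+1.6\,T^2+0.512$, a polynomial over $\mathbb{V}$. Then $\mathrm{mult}_{0.8}(\overline{p})=3$, and for every polynomial $p\in\mathbb{C}[T]$ corresponding to $\overline{p}$ with respect to $f$ (that is, $p(T)=c_3T^3+c_2T^2+c_1T+c_0$ with $|c_3|=1$, $|c_2|=1.6$, $c_1=0$, $|c_0|=0.512$) one has $$\mathrm{mult}_{0.8}(\overline{p})=3>2\geq\sum_{b\in\mathbb{C},\ |b|=0.8}\mathrm{mult}_b(p).$$ In particular, the inequality $\mathrm{mult}_a(\overline{p})\ge\sum_{b\in f^{-1}(a)}\mathrm{mult}_b(p)$ is not sharp under $f:\mathbb{C}\to\mathbb{V}$: for this $\overline{p}$ and $a=0.8$, no corresponding polynomial $p$ attains equality.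
   Context: The Viro hyperfield $\mathbb{V}$ is the set $\mathbb{R}_{\ge 0}$ with the usual multiplication and the hyperaddition $x\boxplus y=\{z\in\mathbb{R}_{\ge0}: |x-y|\le z\le x+y\}$; every element is its own hyperinverse, $-x=x$. For subsets, $A\boxplus B=\bigcup_{a\in A,b\in B}a\boxplus b$, and iterated hypersums are defined accordingly ($\boxplus$ is associative and commutative). A polynomial over a hyperfield $\mathbb{F}$ is a formal expression $p(T)=c_nT^n+\cdots+c_1T+c_0$ with $c_i\in\mathbb{F}$, $c_n\ne0$ (degree $n$). For polynomials $p=\sum_{k\le n} c_kT^k$ and $q=\sum_{l\le m} d_lT^l$, the product $p\boxdot q$ is the set of all $\sum_{i=0}^{n+m}e_iT^i$ with $e_i\in\boxplus_{k+l=i}c_kd_l$ for every $i$. An element $a\in\mathbb{F}$ is a root of $p$ if $0\in c_na^n\boxplus\cdots\boxplus c_1a\boxplus c_0$ (equivalently, $p\in(T-a)\boxdot q$ for some polynomial $q$ over $\mathbb{F}$). The multiplicity is defined recursively: $\mathrm{mult}_a(p)=0$ if $a$ is not a root of $p$, and otherwise $\mathrm{mult}_a(p)=1+\max\{\mathrm{mult}_a(q): p\in(T-a)\boxdot q\}$. For a field (viewed as a hyperfield with $x\boxplus y=\{x+y\}$) this is the usual multiplicity of a root. *)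

theory Defs
  imports Complex_Main "HOL-Computational_Algebra.Polynomial"
begin

section \<open>Hyperfields\<close>

definition hadd_set :: "('a \<Rightarrow> 'a \<Rightarrow> 'a set) \<Rightarrow> 'a set \<Rightarrow> 'a set \<Rightarrow> 'a set" where
  "hadd_set h A B = (\<Union>a\<in>A. \<Union>b\<in>B. h a b)"

class hyperfield = comm_monoid_mult + mult_zero + zero_neq_one + uminus +
  fixes hadd :: "'a \<Rightarrow> 'a \<Rightarrow> 'a set"  (infixl \<open>\<boxplus>\<close> 65)
  assumes hadd_nonempty: "x \<boxplus> y \<noteq> {}"
    and hadd_commute: "x \<boxplus> y = y \<boxplus> x"
    and hadd_assoc: "hadd_set hadd (x \<boxplus> y) {z} = hadd_set hadd {x} (y \<boxplus> z)"
    and hadd_0_right: "x \<boxplus> 0 = {x}"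
    and zero_in_hadd_iff: "0 \<in> x \<boxplus> y \<longleftrightarrow> y = - x"
    and hadd_reversible: "z \<in> x \<boxplus> y \<Longrightarrow> y \<in> z \<boxplus> - x"
    and hadd_distrib: "(\<lambda>z. c * z) ` (x \<boxplus> y) = (c * x) \<boxplus> (c * y)"
    and nonzero_invertible: "x \<noteq> 0 \<Longrightarrow> \<exists>y. x * y = 1"

text \<open>The iterated hypersum \<open>f 0 \<boxplus> \<dots> \<boxplus> f n\<close>.\<close>

primrec hsum :: "(nat \<Rightarrow> 'a::hyperfield) \<Rightarrow> nat \<Rightarrow> 'a set" where
  "hsum f 0 = {f 0}"
| "hsum f (Suc n) = hadd_set hadd (hsum f n) {f (Suc n)}"


section \<open>Polynomials over a hyperfield and multiplicities\<close>

text \<open>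
  The type \<open>'a poly\<close> only requires a zero, so \<open>'a poly\<close> with \<open>coeff\<close> and
  \<open>degree\<close> serves as the set of formal polynomials over a hyperfield
  (plus the zero polynomial).
\<close>

definition hpoly_mult :: "'a::hyperfield poly \<Rightarrow> 'a poly \<Rightarrow> 'a poly set"  (infixl \<open>\<boxdot>\<close> 70) where
  "p \<boxdot> q = {r. degree r \<le> degree p + degree q \<and>
     (\<forall>i \<le> degree p + degree q. coeff r i \<in> hsum (\<lambda>k. coeff p k * coeff q (i - k)) i)}"

definition hroot :: "'a::hyperfield poly \<Rightarrow> 'a \<Rightarrow> bool" where
  "hroot p a \<longleftrightarrow> 0 \<in> hsum (\<lambda>i. coeff p i * a ^ i) (degree p)"

lemma hadd_0_left: "0 \<boxplus> x = {x :: 'a::hyperfield}"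
  by (subst hadd_commute) (rule hadd_0_right)

lemma hsum_zero: "(\<And>k. k \<le> n \<Longrightarrow> f k = 0) \<Longrightarrow> hsum f n = {0}"
  by (induction n) (auto simp: hadd_set_def hadd_0_right)

lemma hsum_single:
  assumes "m \<le> n" "\<And>k. k \<le> n \<Longrightarrow> k \<noteq> m \<Longrightarrow> f k = 0"
  shows "hsum f n = {f m}"
  using assms
proof (induction n)
  case 0
  then show ?case by simp
next
  case (Suc n)
  show ?case
  proof (cases "m = Suc n")
    case True
    then have "hsum f n = {0}" using Suc.prems by (intro hsum_zero) auto
    then show ?thesis using True by (auto simp: hadd_set_def hadd_0_left)
  next
    case False
    then have "hsum f n = {f m}" using Suc by auto
    moreover have "f (Suc n) = 0" using Suc.prems False by auto
    ultimately show ?thesis by (auto simp: hadd_set_def hadd_0_right)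
  qed
qed

lemma linear_factor_degree:
  fixes p q :: "'a::hyperfield poly"
  assumes "p \<noteq> 0" "p \<in> [:- a, 1:] \<boxdot> q"
  shows "degree p = Suc (degree q)" "q \<noteq> 0"
proof -
  let ?t = "\<lambda>i k. coeff [:- a, 1:] k * coeff q (i - k)"
  have c: "coeff p i \<in> hsum (?t i) i" if "i \<le> Suc (degree q)" for i
    using assms that by (auto simp: hpoly_mult_def)
  show q0: "q \<noteq> 0"
  proof
    assume "q = 0"
    then have "coeff p i = 0" for i
    proof (cases "i \<le> Suc (degree q)")
      case True
      have "hsum (?t i) i = {0}" using \<open>q = 0\<close> by (intro hsum_zero) auto
      with c[OF True] show ?thesis by auto
    next
      case False
      then show ?thesis using assms by (intro coeff_eq_0) (auto simp: hpoly_mult_def)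
    qed
    then show False using assms(1) by (auto simp: poly_eq_iff)
  qed
  have "hsum (?t (Suc (degree q))) (Suc (degree q)) = {?t (Suc (degree q)) 1}"
  proof (rule hsum_single)
    fix k assume "k \<le> Suc (degree q)" "k \<noteq> 1"
    then show "?t (Suc (degree q)) k = 0"
      by (cases k) (auto simp: coeff_eq_0 coeff_pCons split: nat.splits)
  qed simp
  then have "coeff p (Suc (degree q)) = coeff q (degree q)"
    using c[of "Suc (degree q)"] by simp
  then have "coeff p (Suc (degree q)) \<noteq> 0" using q0 by simp
  then have "Suc (degree q) \<le> degree p" by (rule le_degree)
  then show "degree p = Suc (degree q)" using assms by (auto simp: hpoly_mult_def)
qed

lemma minus_0_hyper: "- (0::'a::hyperfield) = 0"
  using zero_in_hadd_iff[of "0::'a" 0] by (auto simp: hadd_0_right)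

lemma minus_minus_hyper: "- (- x) = (x::'a::hyperfield)"
  using zero_in_hadd_iff[of x "- x"] zero_in_hadd_iff[of "- x" x] by (simp add: hadd_commute)

lemma minus_mult_hyper: "- x * y = - (x * (y::'a::hyperfield))"
proof -
  have "0 \<in> x \<boxplus> - x" by (simp add: zero_in_hadd_iff)
  then have "y * 0 \<in> (\<lambda>z. y * z) ` (x \<boxplus> - x)" by (rule imageI)
  then have "0 \<in> (y * x) \<boxplus> (y * - x)" by (simp add: hadd_distrib)
  then show ?thesis by (simp add: zero_in_hadd_iff mult.commute)
qed

lemma hadd_mult_cancel:
  fixes c :: "'a::hyperfield"
  assumes "c \<noteq> 0"
  shows "c * z \<in> (c * x) \<boxplus> (c * y) \<longleftrightarrow> z \<in> x \<boxplus> y"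
proof
  obtain d where d: "c * d = 1" using nonzero_invertible[OF assms] by blast
  then have d': "d * (c * w) = w" for w by (metis mult.assoc mult.commute mult_1)
  show "z \<in> x \<boxplus> y" if "c * z \<in> (c * x) \<boxplus> (c * y)"
    using imageI[OF that, of "\<lambda>z. d * z"] by (simp add: hadd_distrib d')
  show "c * z \<in> (c * x) \<boxplus> (c * y)" if "z \<in> x \<boxplus> y"
    using imageI[OF that, of "\<lambda>z. c * z"] by (simp add: hadd_distrib)
qed

lemma hsum_two:
  assumes "\<And>k. 2 \<le> k \<Longrightarrow> f k = 0"
  shows "hsum f (Suc n) = f 0 \<boxplus> f 1"
  using assms by (induction n) (auto simp: hadd_set_def hadd_0_right)

lemma linear_hpoly_mult_iff:
  fixes q :: "'a::hyperfield poly"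
  shows "p \<in> [:- a, 1:] \<boxdot> q \<longleftrightarrow> degree p \<le> Suc (degree q) \<and> coeff p 0 = - a * coeff q 0 \<and>
    (\<forall>i \<le> degree q. coeff p (Suc i) \<in> (- a * coeff q (Suc i)) \<boxplus> coeff q i)"
proof -
  have "hsum (\<lambda>k. coeff [:- a, 1:] k * coeff q (Suc i - k)) (Suc i) =
      (- a * coeff q (Suc i)) \<boxplus> coeff q i" for i
    by (subst hsum_two) (auto simp: coeff_pCons split: nat.splits)
  moreover have "(\<forall>i \<le> Suc n. P i) \<longleftrightarrow> P 0 \<and> (\<forall>i \<le> n. P (Suc i))" for n P
    by (metis Suc_le_mono le0 not0_implies_Suc)
  ultimately show ?thesis by (simp add: hpoly_mult_def)
qed

lemma hsum_partial_sums:
  "x \<in> hsum f n \<longleftrightarrow> (\<exists>s. s 0 = f 0 \<and> (\<forall>k<n. s (Suc k) \<in> s k \<boxplus> f (Suc k)) \<and> s n = x)"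
proof (induction n arbitrary: x)
  case 0
  then show ?case by auto
next
  case (Suc n)
  show ?case
  proof
    assume "x \<in> hsum f (Suc n)"
    then obtain y where "y \<in> hsum f n" "x \<in> y \<boxplus> f (Suc n)" by (auto simp: hadd_set_def)
    then obtain s where "s 0 = f 0" "\<forall>k<n. s (Suc k) \<in> s k \<boxplus> f (Suc k)" "s n = y"
      using Suc.IH by auto
    with \<open>x \<in> y \<boxplus> f (Suc n)\<close>
    show "\<exists>s. s 0 = f 0 \<and> (\<forall>k<Suc n. s (Suc k) \<in> s k \<boxplus> f (Suc k)) \<and> s (Suc n) = x"
      by (intro exI[of _ "s(Suc n := x)"]) (auto simp: less_Suc_eq)
  next
    assume "\<exists>s. s 0 = f 0 \<and> (\<forall>k<Suc n. s (Suc k) \<in> s k \<boxplus> f (Suc k)) \<and> s (Suc n) = x"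
    then obtain s where s: "s 0 = f 0" "\<forall>k<Suc n. s (Suc k) \<in> s k \<boxplus> f (Suc k)" "s (Suc n) = x"
      by blast
    then have "s n \<in> hsum f n" using Suc.IH by auto
    then show "x \<in> hsum f (Suc n)" using s by (auto simp: hadd_set_def)
  qed
qed

text \<open>The two descriptions of a root agree.\<close>

lemma hroot_iff_linear_factor:
  fixes p :: "'a::hyperfield poly"
  assumes "p \<noteq> 0"
  shows "hroot p a \<longleftrightarrow> (\<exists>q. p \<in> [:- a, 1:] \<boxdot> q)"
proof
  let ?f = "\<lambda>i. coeff p i * a ^ i"
  have rev: "z \<in> x \<boxplus> y \<longleftrightarrow> y \<in> z \<boxplus> - x" for x y z :: 'a
    using hadd_reversible[of z x y] hadd_reversible[of y "- x" z]
    by (auto simp: hadd_commute minus_minus_hyper)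
  {
    assume "\<exists>q. p \<in> [:- a, 1:] \<boxdot> q"
    then obtain q where q: "p \<in> [:- a, 1:] \<boxdot> q" by blast
    have deg: "degree p = Suc (degree q)" using linear_factor_degree[OF assms q] by simp
    define s where "s = (\<lambda>k. - a * (a ^ k * coeff q k))"
    have "s (Suc k) \<in> s k \<boxplus> ?f (Suc k)" if "k \<le> degree q" for k
    proof -
      have "coeff p (Suc k) \<in> (- a * coeff q (Suc k)) \<boxplus> coeff q k"
        using q that by (auto simp: linear_hpoly_mult_iff)
      then have "a ^ Suc k * coeff p (Suc k) \<in>
          (a ^ Suc k * (- a * coeff q (Suc k))) \<boxplus> (a ^ Suc k * coeff q k)"
        unfolding hadd_distrib[symmetric] by (rule imageI)
      moreover have "a ^ Suc k * (- a * coeff q (Suc k)) = s (Suc k)"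
        unfolding s_def by (rule mult.left_commute)
      moreover have "a ^ Suc k * coeff q k = a * (a ^ k * coeff q k)"
        by (simp add: mult.assoc)
      ultimately have "?f (Suc k) \<in> s (Suc k) \<boxplus> (a * (a ^ k * coeff q k))"
        by (metis mult.commute)
      moreover have "a * (a ^ k * coeff q k) = - s k"
        by (simp add: s_def minus_mult_hyper minus_minus_hyper)
      ultimately show ?thesis by (subst rev) simp
    qed
    moreover have "s 0 = ?f 0" using q by (simp add: linear_hpoly_mult_iff s_def)
    moreover have "s (degree p) = 0" by (simp add: s_def deg coeff_eq_0)
    ultimately show "hroot p a" unfolding hroot_def hsum_partial_sums
      by (intro exI[of _ s]) (simp add: deg)
  }
  assume "hroot p a"
  then obtain s where s: "s 0 = ?f 0" "\<And>k. k < degree p \<Longrightarrow> s (Suc k) \<in> s k \<boxplus> ?f (Suc k)"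
    "s (degree p) = 0"
    unfolding hroot_def hsum_partial_sums by auto
  have "degree p \<noteq> 0"
  proof
    assume d: "degree p = 0"
    then have "coeff p 0 = 0" using s by simp
    then show False using d assms leading_coeff_neq_0[of p] by simp
  qed
  then obtain n where n: "degree p = Suc n" by (cases "degree p") auto
  show "\<exists>q. p \<in> [:- a, 1:] \<boxdot> q"
  proof (cases "a = 0")
    case True
    have p: "p = pCons (coeff p 0) (poly_shift 1 p)"
      by (rule poly_eqI) (auto simp: coeff_pCons coeff_poly_shift split: nat.splits)
    have s0: "s k = coeff p 0" if "k \<le> degree p" for k
      using that by (induction k) (use s True in \<open>auto simp: hadd_0_right Suc_le_eq\<close>)
    then have p0: "coeff p 0 = 0" using s by force
    have sh: "degree (poly_shift 1 p) = n"
      using p n p0 by (metis degree_pCons_eq_if nat.inject nat.distinct(1))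
    have "p \<in> [:- a, 1:] \<boxdot> poly_shift 1 p"
      unfolding linear_hpoly_mult_iff sh
      by (simp add: True minus_0_hyper p0 n coeff_poly_shift hadd_0_left)
    then show ?thesis by blast
  next
    case False
    obtain b where b: "a * b = 1" using nonzero_invertible[OF False] by blast
    have ab: "a ^ k * b ^ k = 1" for k
      by (simp add: b flip: power_mult_distrib)
    have nz: "a ^ k \<noteq> 0" for k using ab[of k] by auto
    define q where "q = Poly (map (\<lambda>k. - (s k * b ^ Suc k)) [0..<Suc n])"
    have cq: "coeff q k = - (s k * b ^ Suc k)" if "k \<le> Suc n" for k
    proof (cases "k = Suc n")
      case True
      have "coeff q k = 0" by (simp add: q_def nth_default_def True del: upt_Suc)
      moreover have "s k = 0" using s(3) n True by simp
      ultimately show ?thesis by (simp add: minus_0_hyper)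
    next
      case False
      then show ?thesis using that by (simp add: q_def nth_default_def del: upt_Suc)
    qed
    have mm: "- a * - x = a * x" for x
      by (metis minus_mult_hyper minus_minus_hyper mult.commute)
    have aq: "- a * (a ^ k * coeff q k) = s k" if "k \<le> Suc n" for k
    proof -
      have "a ^ k * - (s k * b ^ Suc k) = - (a ^ k * (s k * b ^ Suc k))"
        using minus_mult_hyper[of "s k * b ^ Suc k" "a ^ k"] by (simp only: mult.commute)
      then have "- a * (a ^ k * - (s k * b ^ Suc k)) = a * (a ^ k * (s k * b ^ Suc k))"
        by (simp only: mm)
      also have "\<dots> = (a ^ Suc k * b ^ Suc k) * s k"
        by (simp only: power_Suc mult_ac)
      finally have "- a * (a ^ k * - (s k * b ^ Suc k)) = (a ^ Suc k * b ^ Suc k) * s k" .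
      then show ?thesis using that by (simp add: cq ab del: power_Suc)
    qed
    have main: "coeff p (Suc k) \<in> (- a * coeff q (Suc k)) \<boxplus> coeff q k" if "k \<le> n" for k
    proof -
      have "s (Suc k) \<in> s k \<boxplus> ?f (Suc k)" using s(2) that n by simp
      then have "?f (Suc k) \<in> s (Suc k) \<boxplus> - s k" by (rule hadd_reversible)
      moreover have "- s k = a ^ Suc k * coeff q k"
        using aq[of k] that
        by (simp only: minus_mult_hyper minus_minus_hyper mult.assoc power_Suc le_SucI flip: aq)
      moreover have "s (Suc k) = a ^ Suc k * (- a * coeff q (Suc k))"
        using aq[of "Suc k"] that by (simp only: mult.left_commute[of _ "- a"] Suc_le_mono)
      ultimately have "a ^ Suc k * coeff p (Suc k) \<in>
          (a ^ Suc k * (- a * coeff q (Suc k))) \<boxplus> (a ^ Suc k * coeff q k)"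
        by (simp only: mult.commute[of "coeff p (Suc k)"])
      then show ?thesis by (simp only: hadd_mult_cancel[OF nz])
    qed
    have dq: "degree q \<le> n"
      by (rule degree_le) (auto simp: q_def nth_default_def simp del: upt_Suc)
    have "coeff q (Suc n) = 0" using cq[of "Suc n"] s(3) n by (simp add: minus_0_hyper)
    then have "coeff p (Suc n) = coeff q n"
      using main[of n] by (simp add: hadd_0_left)
    then have "coeff q n \<noteq> 0" using assms n leading_coeff_neq_0[of p] by simp
    then have "degree q = n" using dq le_degree[of q n] by simp
    moreover have "coeff p 0 = - a * coeff q 0" using aq[of 0] s(1) by simp
    ultimately have "p \<in> [:- a, 1:] \<boxdot> q" using main n by (simp add: linear_hpoly_mult_iff)
    then show ?thesis by blast
  qed
qed

text \<open>
  Polynomials in the mathematical sense are nonzero; the zero polynomial gets the dummy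
  value 0.  For \<open>p \<noteq> 0\<close> the set under \<open>Max\<close> is finite by
  \<open>hmult_set_finite\<close>, and for a root \<open>a\<close> of \<open>p\<close> it is nonempty by
  \<open>hroot_iff_linear_factor\<close>.
\<close>

function hmult :: "'a::hyperfield \<Rightarrow> 'a poly \<Rightarrow> nat" where
  "hmult a p = (if p \<noteq> 0 \<and> hroot p a then 1 + Max (hmult a ` {q. p \<in> [:- a, 1:] \<boxdot> q}) else 0)"
  by auto
termination
  by (relation "Wellfounded.measure (\<lambda>(a, p). degree p)") (auto dest: linear_factor_degree)

declare hmult.simps [simp del]

lemma hmult_le_degree: "hmult a p \<le> degree p"
proof (induction "degree p" arbitrary: p rule: less_induct)
  case less
  show ?case
  proof (cases "p \<noteq> 0 \<and> hroot p a")
    case True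
    let ?Q = "{q. p \<in> [:- a, 1:] \<boxdot> q}"
    have *: "Suc (hmult a q) \<le> degree p" if "q \<in> ?Q" for q
      using that True less[of q] linear_factor_degree(1)[of p a q] by auto
    then have "hmult a ` ?Q \<subseteq> {..degree p}" by force
    then have fin: "finite (hmult a ` ?Q)" by (rule finite_subset) simp
    obtain q where q: "q \<in> ?Q" using True hroot_iff_linear_factor by auto
    then have "Max (hmult a ` ?Q) \<in> hmult a ` ?Q" using fin by (intro Max_in) auto
    then obtain r where r: "r \<in> ?Q" "Max (hmult a ` ?Q) = hmult a r" by (rule imageE)
    have "Suc (Max (hmult a ` ?Q)) \<le> degree p" unfolding r(2) by (rule *[OF r(1)])
    then show ?thesis using True by (subst hmult.simps) simp
  next
    case False
    then show ?thesis by (subst hmult.simps) (simp only: if_False le0)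
  qed
qed

lemma hmult_set_finite:
  assumes "p \<noteq> 0"
  shows "finite (hmult a ` {q. p \<in> [:- a, 1:] \<boxdot> q})"
proof (rule finite_subset)
  have "hmult a q \<le> degree p" if "p \<in> [:- a, 1:] \<boxdot> q" for q
    using linear_factor_degree(1)[OF assms that] hmult_le_degree[of a q] by simp
  then show "hmult a ` {q. p \<in> [:- a, 1:] \<boxdot> q} \<subseteq> {..degree p}" by auto
qed simp


section \<open>The Viro hyperfield\<close>

typedef viro = "{x::real. 0 \<le> x}"
  morphisms viro_val Viro
  by auto

lemma viro_val_nonneg: "0 \<le> viro_val x"
  using viro_val by auto

lemma viro_val_Viro: "0 \<le> x \<Longrightarrow> viro_val (Viro x) = x"
  by (rule Viro_inverse) simp

lemma viro_eq_iff: "x = y \<longleftrightarrow> viro_val x = viro_val y"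
  by (simp add: viro_val_inject)

instantiation viro :: hyperfield
begin

definition zero_viro :: viro where "0 = Viro 0"
definition one_viro :: viro where "1 = Viro 1"
definition times_viro :: "viro \<Rightarrow> viro \<Rightarrow> viro" where "x * y = Viro (viro_val x * viro_val y)"
definition uminus_viro :: "viro \<Rightarrow> viro" where "- x = (x :: viro)"
definition hadd_viro :: "viro \<Rightarrow> viro \<Rightarrow> viro set" where
  "x \<boxplus> y = {z. \<bar>viro_val x - viro_val y\<bar> \<le> viro_val z \<and> viro_val z \<le> viro_val x + viro_val y}"

instance
proof
  note [simp] = viro_val_Viro viro_val_nonneg zero_viro_def one_viro_def times_viro_def
    uminus_viro_def
  fix x y z c :: viro
  show "x * y * z = x * (y * z)" "x * y = y * x" "1 * x = x" "0 * x = 0" "x * 0 = 0"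
    "(0::viro) \<noteq> 1"
    by (auto simp: viro_eq_iff)
  have "Viro (viro_val x + viro_val y) \<in> x \<boxplus> y"
    using viro_val_nonneg[of x] viro_val_nonneg[of y]
    by (simp add: hadd_viro_def abs_le_iff)
  then show "x \<boxplus> y \<noteq> {}" by auto
  show "x \<boxplus> y = y \<boxplus> x" by (auto simp: hadd_viro_def)
  show "x \<boxplus> 0 = {x}"
    using viro_val_nonneg[of x] by (auto simp: hadd_viro_def viro_eq_iff)
  show "0 \<in> x \<boxplus> y \<longleftrightarrow> y = - x"
    using viro_val_nonneg[of x] viro_val_nonneg[of y] by (auto simp: hadd_viro_def viro_eq_iff)
  show "y \<in> z \<boxplus> - x" if "z \<in> x \<boxplus> y" using that by (auto simp: hadd_viro_def)
  show "\<exists>y. x * y = 1" if "x \<noteq> 0"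
    using that viro_val_nonneg[of x]
    by (intro exI[of _ "Viro (1 / viro_val x)"]) (auto simp: viro_eq_iff)
  have half: "\<exists>v. v \<in> y \<boxplus> z \<and> w \<in> x \<boxplus> v" if "u \<in> x \<boxplus> y" "w \<in> u \<boxplus> z" for x y z u w :: viro
  proof -
    define m where "m = max \<bar>viro_val y - viro_val z\<bar> \<bar>viro_val w - viro_val x\<bar>"
    have m: "viro_val (Viro m) = m" by (rule viro_val_Viro) (auto simp: m_def)
    note h = that[unfolded hadd_viro_def mem_Collect_eq]
    note nn = viro_val_nonneg[of x] viro_val_nonneg[of y] viro_val_nonneg[of z]
      viro_val_nonneg[of w]
    have "m \<le> viro_val y + viro_val z" unfolding m_def using h nn by linarith
    moreover have "m \<le> viro_val x + viro_val w" unfolding m_def using h nn by linarith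
    moreover have "viro_val w \<le> viro_val x + m" unfolding m_def by linarith
    moreover have "viro_val x \<le> viro_val w + m" unfolding m_def by linarith
    moreover have "\<bar>viro_val y - viro_val z\<bar> \<le> m" unfolding m_def by simp
    moreover have "m \<le> viro_val w + viro_val x" using calculation by simp
    ultimately have "Viro m \<in> y \<boxplus> z \<and> w \<in> x \<boxplus> Viro m"
      unfolding hadd_viro_def mem_Collect_eq m by linarith
    then show ?thesis by blast
  qed
  have comm: "x \<boxplus> y = y \<boxplus> x" for x y :: viro by (auto simp: hadd_viro_def)
  show "hadd_set hadd (x \<boxplus> y) {z} = hadd_set hadd {x} (y \<boxplus> z)"
  proof (rule set_eqI)
    fix w
    have "(\<exists>u. u \<in> x \<boxplus> y \<and> w \<in> u \<boxplus> z) \<longleftrightarrow> (\<exists>v. v \<in> y \<boxplus> z \<and> w \<in> x \<boxplus> v)"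
      using half[of _ x y w z] half[of _ z y w x] by (metis comm)
    then show "w \<in> hadd_set hadd (x \<boxplus> y) {z} \<longleftrightarrow> w \<in> hadd_set hadd {x} (y \<boxplus> z)"
      by (auto simp: hadd_set_def)
  qed
  show "(\<lambda>z. c * z) ` (x \<boxplus> y) = (c * x) \<boxplus> (c * y)"
  proof (cases "viro_val c = 0")
    case True
    then have c0: "c * v = 0" for v by (simp add: viro_eq_iff)
    have "(0 :: viro) \<boxplus> 0 = {0}"
      using viro_val_nonneg by (auto simp: hadd_viro_def viro_eq_iff order_antisym[OF _ viro_val_nonneg])
    then show ?thesis using \<open>x \<boxplus> y \<noteq> {}\<close> by (simp only: c0 image_constant_conv if_False)
  next
    case False
    then have c: "viro_val c > 0" using viro_val_nonneg[of c] by linarith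
    have ab: "\<bar>viro_val c * s - viro_val c * t\<bar> = viro_val c * \<bar>s - t\<bar>" for s t :: real
      using c by (simp add: abs_mult flip: right_diff_distrib)
    show ?thesis
    proof (intro equalityI subsetI)
      fix w assume "w \<in> (\<lambda>z. c * z) ` (x \<boxplus> y)"
      then show "w \<in> (c * x) \<boxplus> (c * y)"
        using c by (auto simp: hadd_viro_def ab simp flip: distrib_left)
    next
      fix w assume "w \<in> (c * x) \<boxplus> (c * y)"
      then have w: "viro_val c * \<bar>viro_val x - viro_val y\<bar> \<le> viro_val w"
        "viro_val w \<le> viro_val c * (viro_val x + viro_val y)"
        by (auto simp: hadd_viro_def ab distrib_left)
      have "w = c * Viro (viro_val w / viro_val c)" using c by (auto simp: viro_eq_iff)
      moreover have "Viro (viro_val w / viro_val c) \<in> x \<boxplus> y"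
        using w c by (auto simp: hadd_viro_def field_simps)
      ultimately show "w \<in> (\<lambda>z. c * z) ` (x \<boxplus> y)" by blast
    qed
  qed
qed

end

definition viro_abs :: "complex \<Rightarrow> viro" where
  "viro_abs z = Viro (cmod z)"


section \<open>Corresponding polynomials\<close>

definition corresponds :: "('a::zero \<Rightarrow> 'b::zero) \<Rightarrow> 'a poly \<Rightarrow> 'b poly \<Rightarrow> bool" where
  "corresponds f p pbar \<longleftrightarrow> (\<forall>i. f (coeff p i) = coeff pbar i)"

text \<open>
  The sum of \<open>order b p\<close> over the fibre \<open>f -` {a}\<close>.  The fibre may be
  infinite, and \<open>sum\<close> over an infinite set is 0; we therefore restrict to the roots of
  \<open>p\<close>, which for \<open>p \<noteq> 0\<close> are finitely many and carry all nonzero summands.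
\<close>

definition fibre_mult :: "('a::idom \<Rightarrow> 'b) \<Rightarrow> 'b \<Rightarrow> 'a poly \<Rightarrow> nat" where
  "fibre_mult f a p = (\<Sum>b | f b = a \<and> poly p b = 0. order b p)"

end

theory Submission
  imports Defs
begin

text \<open>
  Over the Viro hyperfield, three linear factors can be split off in turn, with quotients
  \<open>T\<^sup>2 + 0.8 T + 0.64\<close>, \<open>T + 0.8\<close> and \<open>1\<close>.  Over the complex
  numbers, a root \<open>b\<close> of modulus \<open>0.8\<close> makes the triangle inequality for
  \<open>c\<^sub>2 b\<^sup>2 = - (c\<^sub>3 b\<^sup>3 + c\<^sub>0)\<close> tight,
  as \<open>1.024 = 0.512 + 0.512\<close>.  Hence \<open>c\<^sub>3 b\<^sup>3 = c\<^sub>0\<close>, which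
  determines \<open>b = - c\<^sub>2 / (2 c\<^sub>3)\<close>; and this single root is not triple
  because the linear coefficient of \<open>c (T - b)\<^sup>3\<close> is \<open>3 c b\<^sup>2 \<noteq> 0\<close>.
\<close>

text \<open>Lets an explicit chain of quotients bound the multiplicity from below, with no need to
  survey all quotients under the maximum.\<close>

lemma hmult_linear_factor_ge:
  assumes "p \<noteq> 0" "p \<in> [:- a, 1:] \<boxdot> q"
  shows "Suc (hmult a q) \<le> hmult a p"
proof -
  have "hroot p a" using assms hroot_iff_linear_factor by blast
  moreover have "hmult a q \<le> Max (hmult a ` {q. p \<in> [:- a, 1:] \<boxdot> q})"
    using assms hmult_set_finite by (intro Max_ge) auto
  ultimately show ?thesis using assms(1) by (subst (2) hmult.simps) simp
qed

lemma viro_val_simps [simp]: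
  "viro_val 0 = 0" "viro_val 1 = 1" "viro_val (x * y) = viro_val x * viro_val y" "viro_val (- x) = viro_val x"
  for x y :: viro
  by (simp_all add: zero_viro_def one_viro_def times_viro_def uminus_viro_def viro_val_Viro
      viro_val_nonneg)

lemma hmult_viro_example: "hmult (Viro 0.8) [:Viro 0.512, 0, Viro 1.6, 1:] = 3"
proof -
  let ?a = "Viro 0.8" and ?p = "[:Viro 0.512, 0, Viro 1.6, 1:]"
  \<comment> \<open>Both ends of the interval 0.8 * 0.8 \<boxplus> 0.64 = [0, 1.28] and 0.8
    \<boxplus> 0.8 = [0, 1.6] matter: the linear coefficient 0 is the lower end of the first, and
    1.6 the upper end of the second.\<close>
  have "?p \<in> [:- ?a, 1:] \<boxdot> [:Viro 0.64, Viro 0.8, 1:]"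
    unfolding linear_hpoly_mult_iff
    by (auto simp: hadd_viro_def viro_eq_iff viro_val_Viro le_Suc_eq)
  then have "Suc (hmult ?a [:Viro 0.64, Viro 0.8, 1:]) \<le> hmult ?a ?p"
    by (intro hmult_linear_factor_ge) simp_all
  moreover have "[:Viro 0.64, Viro 0.8, 1:] \<in> [:- ?a, 1:] \<boxdot> [:Viro 0.8, 1:]"
    unfolding linear_hpoly_mult_iff
    by (auto simp: hadd_viro_def viro_eq_iff viro_val_Viro le_Suc_eq)
  then have "Suc (hmult ?a [:Viro 0.8, 1:]) \<le> hmult ?a [:Viro 0.64, Viro 0.8, 1:]"
    by (intro hmult_linear_factor_ge) simp_all
  moreover have "[:Viro 0.8, 1:] \<in> [:- ?a, 1:] \<boxdot> [:1:]"
    unfolding linear_hpoly_mult_iff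
    by (auto simp: hadd_viro_def viro_eq_iff viro_val_Viro)
  then have "Suc (hmult ?a [:1:]) \<le> hmult ?a [:Viro 0.8, 1:]"
    by (intro hmult_linear_factor_ge) simp_all
  ultimately have "3 \<le> hmult ?a ?p" by linarith
  \<comment> \<open>The multiplicity never exceeds the degree.\<close>
  moreover have "hmult ?a ?p \<le> 3"
    using hmult_le_degree[of ?a ?p] by (simp add: numeral_3_eq_3)
  ultimately show ?thesis by simp
qed

text \<open>By the parallelogram law, \<open>x - y\<close> has squared modulus 4 \<open>r\<close>^2
  - 4 \<open>r\<close>^2 = 0.\<close>

lemma eq_if_cmod_add_eq_double:
  assumes "cmod x = r" "cmod y = r" "cmod (x + y) = 2 * r"
  shows "x = y"
proof -
  have "(cmod (x - y))\<^sup>2 + (cmod (x + y))\<^sup>2 = 2 * (cmod x)\<^sup>2 + 2 * (cmod y)\<^sup>2"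
    unfolding cmod_power2 by (simp add: power2_eq_square algebra_simps)
  then show ?thesis using assms by (simp add: power_mult_distrib)
qed

lemma cubic_root_if_cmod_tight:
  fixes p :: "complex poly"
  assumes "p = [:c0, 0, c2, c3:]" "c3 \<noteq> 0" "poly p b = 0" "b \<noteq> 0"
    and "cmod (c3 * b ^ 3) = cmod c0" "cmod (c2 * b\<^sup>2) = 2 * cmod c0"
  shows "b = - c2 / (2 * c3)"
proof -
  have eq: "c3 * b ^ 3 + c0 = - (c2 * b\<^sup>2)"
    using assms(1,3) by (simp add: power2_eq_square power3_eq_cube algebra_simps
        eq_neg_iff_add_eq_0)
  then have "cmod (c3 * b ^ 3 + c0) = 2 * cmod c0"
    using assms(6) by (simp only: norm_minus_cancel)
  then have "c3 * b ^ 3 = c0"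
    using assms(5) by (intro eq_if_cmod_add_eq_double[where r = "cmod c0"]) auto
  \<comment> \<open>Replacing \<open>c0\<close> by \<open>c3 * b ^ 3\<close> in
    \<open>poly p b = 0\<close> leaves an expression divisible by the nonzero
    \<open>b\<^sup>2\<close>, so the cofactor linear in \<open>b\<close> vanishes.\<close>
  moreover have "b\<^sup>2 * (2 * c3 * b + c2) = c3 * b ^ 3 + c3 * b ^ 3 + c2 * b\<^sup>2"
    by (simp add: power2_eq_square power3_eq_cube algebra_simps)
  ultimately have "b\<^sup>2 * (2 * c3 * b + c2) = 0" using eq by simp
  then have "2 * c3 * b = - c2" using assms(4) by (simp add: eq_neg_iff_add_eq_0)
  then show ?thesis using assms(2) by (simp add: field_simps)
qed

lemma order_le_2_if_linear_coeff_0: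
  fixes p :: "complex poly"
  assumes "degree p = 3" "coeff p 1 = 0" "b \<noteq> 0"
  shows "order b p \<le> 2"
proof (rule ccontr)
  assume "\<not> order b p \<le> 2"
  then have "[:- b, 1:] ^ 3 dvd p" by (simp add: order_divides)
  then obtain q where q: "p = [:- b, 1:] ^ 3 * q" by (elim dvdE)
  have "p \<noteq> 0" using assms(1) by auto
  then have "q \<noteq> 0" using q by auto
  \<comment> \<open>Counting degrees makes the cofactor \<open>q\<close> constant.\<close>
  then have "degree p = 3 + degree q"
    unfolding q by (subst degree_mult_eq) (auto simp: degree_power_eq)
  then obtain c where "q = [:c:]" using assms(1) degree_eq_zeroE[of q] by auto
  moreover have "coeff p 1 = 3 * b\<^sup>2 * c"
    by (simp add: q \<open>q = [:c:]\<close> power3_eq_cube power2_eq_square)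
  ultimately show False using assms \<open>q \<noteq> 0\<close> by auto
qed

lemma fibre_mult_example_le_2:
  assumes "corresponds viro_abs p [:Viro 0.512, 0, Viro 1.6, 1:]"
  shows "fibre_mult viro_abs (Viro 0.8) p \<le> 2"
proof -
  let ?pbar = "[:Viro 0.512, 0, Viro 1.6, 1:]"
  have "cmod (coeff p i) = viro_val (coeff ?pbar i)" for i
    using assms by (metis corresponds_def viro_abs_def viro_val_Viro norm_ge_zero)
  note c = this[of 0] this[of 1] this[of 2] this[of 3] this
  define c0 c2 c3 where "c0 = coeff p 0" and "c2 = coeff p 2" and "c3 = coeff p 3"
  have n: "cmod c0 = 0.512" "cmod c2 = 1.6" "cmod c3 = 1" "coeff p 1 = 0"
    using c(1-4) by (simp_all add: c0_def c2_def c3_def viro_val_Viro numeral_2_eq_2 numeral_3_eq_3)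
  have hi: "coeff p i = 0" if "i > 3" for i
    using c(5)[of i] that by (simp add: coeff_eq_0)
  have p: "p = [:c0, 0, c2, c3:]"
    using n(4) hi by (intro poly_eqI)
      (auto simp: c0_def c2_def c3_def coeff_pCons numeral_2_eq_2 numeral_3_eq_3
        split: nat.splits)
  have c3: "c3 \<noteq> 0" using n(3) by auto
  then have deg: "degree p = 3" by (simp add: p)
  define b where "b = - c2 / (2 * c3)"
  have "cmod b = 0.8" by (simp add: b_def norm_divide norm_mult n)
  then have b: "b \<noteq> 0" by auto
  have root: "z = b" if "viro_abs z = Viro 0.8" "poly p z = 0" for z
  proof -
    have z: "cmod z = 0.8"
      using that(1) by (metis viro_abs_def viro_val_Viro norm_ge_zero zero_le_divide_iff
          zero_le_numeral)
    then have "z \<noteq> 0" by auto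
    then show ?thesis unfolding b_def
      by (rule cubic_root_if_cmod_tight[OF p c3 that(2)])
        (simp_all add: norm_mult norm_power n z power_divide)
  qed
  \<comment> \<open>Only an inequality: the roots of modulus 0.8 lie in \<open>{b}\<close>, but
    \<open>b\<close> itself may fail to be a root.\<close>
  have "fibre_mult viro_abs (Viro 0.8) p \<le> (\<Sum>z\<in>{b}. order z p)"
    unfolding fibre_mult_def using root by (intro sum_mono2) auto
  also have "\<dots> \<le> 2"
    using order_le_2_if_linear_coeff_0[OF deg n(4), of b] b by simp
  finally show ?thesis .
qed

theorem mainTheorem1:
  fixes pbar :: "viro poly" and a :: viro
  assumes "pbar = [:Viro 0.512, 0, Viro 1.6, 1:]"
    and "a = Viro 0.8"
  shows "hmult a pbar = 3 \<and>
    (\<forall>p :: complex poly. corresponds viro_abs p pbar \<longrightarrow>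
       hmult a pbar > 2 \<and> 2 \<ge> fibre_mult viro_abs a p) \<and>
    \<not> (\<exists>p :: complex poly. corresponds viro_abs p pbar \<and>
       hmult a pbar = fibre_mult viro_abs a p)"
  unfolding assms hmult_viro_example using fibre_mult_example_le_2 by fastforce

end
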